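(* Let $A,B\in \mathrm{GL}(2,\mathbb{Z})$ be two hyperbolic matrices that commute with each other. Then $G_A^a=G_B^a$, and hence the $C^*$-algebras $C^*(G_A^a)$ and $C^*(G_B^a)$ are isomorphic.
   Context: A matrix $A\in \mathrm{GL}(2,\mathbb{Z})$ (so $\det A=\pm1$) is hyperbolic if it has no eigenvalue of modulus $1$. Its eigenvalues $\lambda_u,\lambda_s$ are then real, labelled so that $|\lambda_u|>1>|\lambda_s|$; let $v_u,v_s\in\mathbb{R}^2$ be corresponding eigenvectors of Euclidean norm $1$. Let $\mathbb{T}^2=\mathbb{R}^2/\mathbb{Z}^2$ with quotient map $q$ and metric $d(x,y)=\inf\{\|z-w\|: q(z)=x,\ q(w)=y\}$; $A$ acts on $\mathbb{T}^2$ as a homeomorphism. The asymptotic groupoid is the equivalence relation $$G_A^a=\{(x,z)\in\mathbb{T}^2\times\mathbb{T}^2:\lim_{n\to\infty}d(A^nx,A^nz)=\lim_{n\to\infty}d(A^{-n}x,A^{-n}z)=0\}$$ with unit space $\mathbb{T}^2$ (the diagonal), product $(x,z)(z,w)=(x,w)$ and inverse $(x,z)^{-1}=(z,x)$. It carries the standard inductive limit topology for Smale spaces: fix a small $\epsilon>0$ and let $G_n$ be the set of pairs $(x,z)$ such that $z\equiv x+sv_s\equiv x+tv_u \pmod{\mathbb{Z}^2}$ for some real $s,t$ with $|\lambda_s|^n|s|<\epsilon$ and $|\lambda_u|^{-n}|t|<\epsilon$; each $G_n$ has the relative topology from $\mathbb{T}^2\times\mathbb{T}^2$, and $G_A^a=\bigcup_n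 G_n$ has the inductive limit topology. This makes $G_A^a$ étale, and $C^*(G_A^a)$ is its groupoid $C^*$-algebra. *)

theory Defs
  imports "HOL-Analysis.Analysis"
begin

section \<open>The torus\<close>

definition integer_vector :: "real^2 \<Rightarrow> bool" where
  "integer_vector v \<longleftrightarrow> (\<forall>i. v $ i \<in> \<int>)"

lemma integer_vector_0: "integer_vector 0"
  and integer_vector_add: "integer_vector v \<Longrightarrow> integer_vector w \<Longrightarrow> integer_vector (v + w)"
  and integer_vector_diff: "integer_vector v \<Longrightarrow> integer_vector w \<Longrightarrow> integer_vector (v - w)"
  and integer_vector_minus: "integer_vector v \<Longrightarrow> integer_vector (- v)"
  by (auto simp: integer_vector_def)

definition lattice_rel :: "real^2 \<Rightarrow> real^2 \<Rightarrow> bool" where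
  "lattice_rel v w \<longleftrightarrow> integer_vector (v - w)"

lemma equivp_lattice_rel: "equivp lattice_rel"
proof (rule equivpI)
  show "reflp lattice_rel"
    by (rule reflpI) (simp add: lattice_rel_def integer_vector_0)
  show "symp lattice_rel"
    by (rule sympI) (metis lattice_rel_def integer_vector_minus minus_diff_eq)
  show "transp lattice_rel"
  proof (rule transpI)
    fix u v w assume "lattice_rel u v" "lattice_rel v w"
    then have "integer_vector ((u - v) + (v - w))"
      unfolding lattice_rel_def by (rule integer_vector_add)
    then show "lattice_rel u w" by (simp add: lattice_rel_def)
  qed
qed

quotient_type torus = "real^2" / lattice_rel
  by (rule equivp_lattice_rel)

definition torus_proj :: "real^2 \<Rightarrow> torus" where
  "torus_proj = abs_torus"

lemma torus_proj_eq_iff: "torus_proj v = torus_proj w \<longleftrightarrow> integer_vector (v - w)"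
  by (simp add: torus_proj_def torus.abs_eq_iff lattice_rel_def)

lemma torus_proj_surj: "\<exists>v. torus_proj v = x"
  unfolding torus_proj_def by (metis Quotient_torus Quotient_abs_rep)

instantiation torus :: metric_space
begin

definition dist_torus :: "torus \<Rightarrow> torus \<Rightarrow> real" where
  "dist_torus x y = Inf {norm (z - w) | z w. torus_proj z = x \<and> torus_proj w = y}"

definition uniformity_torus :: "(torus \<times> torus) filter" where
  "uniformity_torus = (INF e\<in>{0<..}. principal {(x, y). dist x y < e})"

definition open_torus :: "torus set \<Rightarrow> bool" where
  "open_torus U \<longleftrightarrow> (\<forall>x\<in>U. eventually (\<lambda>(x', y). x' = x \<longrightarrow> y \<in> U) uniformity)"

instance
proof
  have bdd: "bdd_below {norm (z - w) | z w. torus_proj z = x \<and> torus_proj w = y}" for x y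
    by (rule bdd_belowI[of _ 0]) auto
  have le: "dist (torus_proj z) (torus_proj w) \<le> norm (z - w)" for z w
    unfolding dist_torus_def by (rule cInf_lower[OF _ bdd]) auto
  have ex: "\<exists>z w. torus_proj z = x \<and> torus_proj w = y \<and> norm (z - w) < dist x y + e"
    if "e > 0" for x y e
  proof -
    obtain a b where ab: "torus_proj a = x" "torus_proj b = y" using torus_proj_surj by metis
    have "{norm (z - w) | z w. torus_proj z = x \<and> torus_proj w = y} \<noteq> {}" using ab by blast
    from cInf_lessD[OF this, of "dist x y + e"] that
    show ?thesis unfolding dist_torus_def by auto
  qed
  show "uniformity = (INF e\<in>{0 <..}. principal {(x::torus, y). dist x y < e})"
    by (rule uniformity_torus_def)
  show "open U \<longleftrightarrow> (\<forall>x\<in>U. \<forall>\<^sub>F (x', y) in uniformity. x' = x \<longrightarrow> y \<in> U)" for U :: "torus set"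
    by (rule open_torus_def)
  show "dist x y = 0 \<longleftrightarrow> x = y" for x y :: torus
  proof
    assume "x = y"
    obtain a where a: "torus_proj a = x" using torus_proj_surj by metis
    have "dist x y \<ge> 0"
      unfolding dist_torus_def using a \<open>x = y\<close> by (intro cInf_greatest) auto
    then show "dist x y = 0" using le[of a a] a \<open>x = y\<close> by simp
  next
    assume d: "dist x y = 0"
    obtain a b where ab: "torus_proj a = x" "torus_proj b = y" using torus_proj_surj by metis
    have near: "\<exists>m. integer_vector m \<and> norm (a - b - m) < e" if "e > 0" for e
    proof -
      obtain z w where zw: "torus_proj z = x" "torus_proj w = y" "norm (z - w) < e"
        using ex[OF \<open>e > 0\<close>, of x y] d by auto
      have "integer_vector ((a - z) - (b - w))"
        using ab zw by (metis integer_vector_diff torus_proj_eq_iff)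
      moreover have "a - b - ((a - z) - (b - w)) = z - w" by simp
      ultimately show ?thesis using zw(3) by metis
    qed
    obtain m where m: "integer_vector m" "norm (a - b - m) < 1/2" using near[of "1/2"] by auto
    have "norm (a - b - m) < e" if "e > 0" for e
    proof -
      obtain k where k: "integer_vector k" "norm (a - b - k) < min e (1/2)"
        using near[of "min e (1/2)"] \<open>e > 0\<close> by auto
      have "norm (k - m) < 1"
        using norm_triangle_ineq4[of "a - b - m" "a - b - k"] m k by (simp add: algebra_simps)
      then have "\<bar>(k - m) $ i\<bar> < 1" for i
        by (metis component_le_norm_cart order_le_less_trans)
      then have "(k - m) $ i = 0" for i
        using integer_vector_diff[OF k(1) m(1)] Ints_nonzero_abs_less1
        unfolding integer_vector_def by blast
      then have "k = m" by (simp add: vec_eq_iff)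
      then show ?thesis using k by simp
    qed
    then have "norm (a - b - m) = 0"
      by (metis less_irrefl norm_ge_zero order_le_less)
    then have "integer_vector (a - b)" using m by simp
    then show "x = y" using ab by (simp flip: torus_proj_eq_iff)
  qed
  show "dist x y \<le> dist x u + dist y u" for x y u :: torus
  proof (rule field_le_epsilon)
    fix e :: real assume "e > 0"
    then have e: "e/2 > 0" by simp
    obtain a b where ab: "torus_proj a = x" "torus_proj b = u" "norm (a - b) < dist x u + e/2"
      using ex[OF e] by blast
    obtain c d where cd: "torus_proj c = y" "torus_proj d = u" "norm (c - d) < dist y u + e/2"
      using ex[OF e] by blast
    have "integer_vector (d - b)" using ab cd by (simp flip: torus_proj_eq_iff)
    then have "torus_proj (c - d + b) = y"
      using cd(1) integer_vector_minus[of "d - b"] torus_proj_eq_iff[of "c - d + b" c]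
      by (simp add: algebra_simps)
    then have "dist x y \<le> norm (a - (c - d + b))" using le ab by metis
    also have "\<dots> \<le> norm (a - b) + norm (c - d)"
      using norm_triangle_ineq4[of "a - b" "c - d"] by (simp add: algebra_simps)
    finally show "dist x y \<le> dist x u + dist y u + e" using ab cd by linarith
  qed
qed

end

section \<open>Hyperbolic integer matrices and their action\<close>

definition eigenpair :: "'a::field^'n^'n \<Rightarrow> 'a \<Rightarrow> 'a^'n \<Rightarrow> bool" where
  "eigenpair M l v \<longleftrightarrow> v \<noteq> 0 \<and> M *v v = l *s v"

abbreviation real_matrix :: "int^2^2 \<Rightarrow> real^2^2" where
  "real_matrix \<equiv> map_matrix of_int"

abbreviation complex_matrix :: "int^2^2 \<Rightarrow> complex^2^2" where
  "complex_matrix \<equiv> map_matrix of_int"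

definition hyperbolic :: "int^2^2 \<Rightarrow> bool" where
  "hyperbolic A \<longleftrightarrow> \<not> (\<exists>l v. eigenpair (complex_matrix A) l v \<and> cmod l = 1)"

definition unstable_eigenvalue :: "int^2^2 \<Rightarrow> real" where
  "unstable_eigenvalue A = (THE l. (\<exists>v. eigenpair (real_matrix A) l v) \<and> \<bar>l\<bar> > 1)"

definition stable_eigenvalue :: "int^2^2 \<Rightarrow> real" where
  "stable_eigenvalue A = (THE l. (\<exists>v. eigenpair (real_matrix A) l v) \<and> \<bar>l\<bar> < 1)"

definition unstable_vector :: "int^2^2 \<Rightarrow> real^2" where
  "unstable_vector A = (SOME v. eigenpair (real_matrix A) (unstable_eigenvalue A) v \<and> norm v = 1)"

definition stable_vector :: "int^2^2 \<Rightarrow> real^2" where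
  "stable_vector A = (SOME v. eigenpair (real_matrix A) (stable_eigenvalue A) v \<and> norm v = 1)"

lift_definition torus_map :: "int^2^2 \<Rightarrow> torus \<Rightarrow> torus" is "\<lambda>A v. real_matrix A *v v"
proof -
  fix A v w assume "lattice_rel v w"
  then show "lattice_rel (real_matrix A *v v) (real_matrix A *v w)"
    unfolding lattice_rel_def integer_vector_def
    by (simp flip: matrix_vector_mult_diff_distrib)
      (auto simp: matrix_vector_mult_def intro!: Ints_sum Ints_mult)
qed

lemma torus_map_proj: "torus_map A (torus_proj v) = torus_proj (real_matrix A *v v)"
  unfolding torus_proj_def by (rule torus_map.abs_eq)

section \<open>Groupoids\<close>

text \<open>Units are identified with identity arrows, so \<open>rng\<close> and \<open>src\<close> take values in the arrows.
  The field \<open>mult\<close> is relevant only on composable pairs of arrows.\<close>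

record 'g topological_groupoid =
  arrows :: "'g set"
  mult :: "'g \<Rightarrow> 'g \<Rightarrow> 'g"
  inverse_arrow :: "'g \<Rightarrow> 'g"
  rng :: "'g \<Rightarrow> 'g"
  src :: "'g \<Rightarrow> 'g"
  arrow_topology :: "'g topology"

definition inductive_limit_topology ::
    "'a::topological_space set \<Rightarrow> (nat \<Rightarrow> 'a set) \<Rightarrow> 'a topology" where
  "inductive_limit_topology G F =
     topology (\<lambda>U. U \<subseteq> G \<and> (\<forall>n. openin (top_of_set (F n)) (U \<inter> F n)))"

lemma openin_inductive_limit_topology:
  "openin (inductive_limit_topology G F) U \<longleftrightarrow>
     U \<subseteq> G \<and> (\<forall>n. openin (top_of_set (F n)) (U \<inter> F n))"
proof -
  have "istopology (\<lambda>U. U \<subseteq> G \<and> (\<forall>n. openin (top_of_set (F n)) (U \<inter> F n)))"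
    unfolding istopology_def
  proof (intro conjI allI impI)
    fix S T n
    assume "S \<subseteq> G \<and> (\<forall>n. openin (top_of_set (F n)) (S \<inter> F n))"
      and "T \<subseteq> G \<and> (\<forall>n. openin (top_of_set (F n)) (T \<inter> F n))"
    then have "openin (top_of_set (F n)) ((S \<inter> F n) \<inter> (T \<inter> F n))" by blast
    moreover have "(S \<inter> F n) \<inter> (T \<inter> F n) = S \<inter> T \<inter> F n" by blast
    ultimately show "openin (top_of_set (F n)) (S \<inter> T \<inter> F n)" by simp
  next
    fix \<K> n
    assume "\<forall>K\<in>\<K>. K \<subseteq> G \<and> (\<forall>n. openin (top_of_set (F n)) (K \<inter> F n))"
    then have "openin (top_of_set (F n)) (\<Union>K\<in>\<K>. K \<inter> F n)" by blast
    moreover have "(\<Union>K\<in>\<K>. K \<inter> F n) = \<Union>\<K> \<inter> F n" by blast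
    ultimately show "openin (top_of_set (F n)) (\<Union>\<K> \<inter> F n)" by simp
  qed blast+
  then show ?thesis
    unfolding inductive_limit_topology_def by (simp add: topology_inverse')
qed

definition asymptotic_relation :: "int^2^2 \<Rightarrow> (torus \<times> torus) set" where
  "asymptotic_relation A = {(x, z).
     (\<lambda>n. dist ((torus_map A ^^ n) x) ((torus_map A ^^ n) z)) \<longlonglongrightarrow> 0 \<and>
     (\<lambda>n. dist ((inv (torus_map A) ^^ n) x) ((inv (torus_map A) ^^ n) z)) \<longlonglongrightarrow> 0}"

definition asymptotic_piece :: "int^2^2 \<Rightarrow> real \<Rightarrow> nat \<Rightarrow> (torus \<times> torus) set" where
  "asymptotic_piece A \<epsilon> n = {(torus_proj x, torus_proj z) | x z.
     \<exists>s t. torus_proj z = torus_proj (x + s *\<^sub>R stable_vector A) \<and>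
           torus_proj z = torus_proj (x + t *\<^sub>R unstable_vector A) \<and>
           \<bar>stable_eigenvalue A\<bar> ^ n * \<bar>s\<bar> < \<epsilon> \<and>
           inverse \<bar>unstable_eigenvalue A\<bar> ^ n * \<bar>t\<bar> < \<epsilon>}"

definition asymptotic_groupoid :: "int^2^2 \<Rightarrow> real \<Rightarrow> (torus \<times> torus) topological_groupoid" where
  "asymptotic_groupoid A \<epsilon> =
     \<lparr> arrows = asymptotic_relation A,
       mult = (\<lambda>(x, z) (z', w). (x, w)),
       inverse_arrow = (\<lambda>(x, z). (z, x)),
       rng = (\<lambda>(x, z). (x, x)),
       src = (\<lambda>(x, z). (z, z)),
       arrow_topology = inductive_limit_topology (asymptotic_relation A) (asymptotic_piece A \<epsilon>) \<rparr>"

section \<open>Star algebras and their Hilbert space representations\<close>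

record 'a star_algebra =
  alg_carrier :: "'a set"
  alg_add :: "'a \<Rightarrow> 'a \<Rightarrow> 'a"
  alg_scale :: "complex \<Rightarrow> 'a \<Rightarrow> 'a"
  alg_mult :: "'a \<Rightarrow> 'a \<Rightarrow> 'a"
  alg_star :: "'a \<Rightarrow> 'a"

record 'a normed_star_algebra = "'a star_algebra" +
  alg_norm :: "'a \<Rightarrow> real"

definition star_isomorphism ::
    "('a, 'c) star_algebra_scheme \<Rightarrow> ('b, 'd) star_algebra_scheme \<Rightarrow> ('a \<Rightarrow> 'b) \<Rightarrow> bool" where
  "star_isomorphism R S \<phi> \<longleftrightarrow>
     bij_betw \<phi> (alg_carrier R) (alg_carrier S) \<and>
     (\<forall>a\<in>alg_carrier R. \<forall>b\<in>alg_carrier R. \<phi> (alg_add R a b) = alg_add S (\<phi> a) (\<phi> b)) \<and>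
     (\<forall>c. \<forall>a\<in>alg_carrier R. \<phi> (alg_scale R c a) = alg_scale S c (\<phi> a)) \<and>
     (\<forall>a\<in>alg_carrier R. \<forall>b\<in>alg_carrier R. \<phi> (alg_mult R a b) = alg_mult S (\<phi> a) (\<phi> b)) \<and>
     (\<forall>a\<in>alg_carrier R. \<phi> (alg_star R a) = alg_star S (\<phi> a))"

definition star_isomorphic ::
    "('a, 'c) star_algebra_scheme \<Rightarrow> ('b, 'd) star_algebra_scheme \<Rightarrow> bool" where
  "star_isomorphic R S \<longleftrightarrow> (\<exists>\<phi>. star_isomorphism R S \<phi>)"

record 'h inner_space =
  vec_carrier :: "'h set"
  vec_zero :: 'h
  vec_add :: "'h \<Rightarrow> 'h \<Rightarrow> 'h"
  vec_scale :: "complex \<Rightarrow> 'h \<Rightarrow> 'h"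
  vec_inner :: "'h \<Rightarrow> 'h \<Rightarrow> complex"

definition vec_norm :: "'h inner_space \<Rightarrow> 'h \<Rightarrow> real" where
  "vec_norm H x = sqrt (Re (vec_inner H x x))"

definition vec_dist :: "'h inner_space \<Rightarrow> 'h \<Rightarrow> 'h \<Rightarrow> real" where
  "vec_dist H x y = vec_norm H (vec_add H x (vec_scale H (-1) y))"

definition complex_vector_space :: "'h inner_space \<Rightarrow> bool" where
  "complex_vector_space H \<longleftrightarrow> (let V = vec_carrier H in
     vec_zero H \<in> V \<and>
     (\<forall>x\<in>V. \<forall>y\<in>V. vec_add H x y \<in> V) \<and>
     (\<forall>c. \<forall>x\<in>V. vec_scale H c x \<in> V) \<and>
     (\<forall>x\<in>V. \<forall>y\<in>V. \<forall>z\<in>V. vec_add H (vec_add H x y) z = vec_add H x (vec_add H y z)) \<and>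
     (\<forall>x\<in>V. \<forall>y\<in>V. vec_add H x y = vec_add H y x) \<and>
     (\<forall>x\<in>V. vec_add H (vec_zero H) x = x) \<and>
     (\<forall>x\<in>V. vec_add H x (vec_scale H (-1) x) = vec_zero H) \<and>
     (\<forall>c. \<forall>x\<in>V. \<forall>y\<in>V. vec_scale H c (vec_add H x y) = vec_add H (vec_scale H c x) (vec_scale H c y)) \<and>
     (\<forall>c d. \<forall>x\<in>V. vec_scale H (c + d) x = vec_add H (vec_scale H c x) (vec_scale H d x)) \<and>
     (\<forall>c d. \<forall>x\<in>V. vec_scale H (c * d) x = vec_scale H c (vec_scale H d x)) \<and>
     (\<forall>x\<in>V. vec_scale H 1 x = x))"

definition hilbert_space :: "'h inner_space \<Rightarrow> bool" where
  "hilbert_space H \<longleftrightarrow> complex_vector_space H \<and> (let V = vec_carrier H in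
     (\<forall>x\<in>V. \<forall>y\<in>V. \<forall>z\<in>V. vec_inner H (vec_add H x y) z = vec_inner H x z + vec_inner H y z) \<and>
     (\<forall>c. \<forall>x\<in>V. \<forall>y\<in>V. vec_inner H (vec_scale H c x) y = c * vec_inner H x y) \<and>
     (\<forall>x\<in>V. \<forall>y\<in>V. vec_inner H y x = cnj (vec_inner H x y)) \<and>
     (\<forall>x\<in>V. 0 \<le> Re (vec_inner H x x)) \<and>
     (\<forall>x\<in>V. vec_inner H x x = 0 \<longrightarrow> x = vec_zero H) \<and>
     (\<forall>X. (\<forall>n. X n \<in> V) \<and> (\<forall>e>0. \<exists>N. \<forall>m\<ge>N. \<forall>n\<ge>N. vec_dist H (X m) (X n) < e) \<longrightarrow>
        (\<exists>l\<in>V. (\<lambda>n. vec_dist H (X n) l) \<longlonglongrightarrow> 0)))"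

definition bounded_operator :: "'h inner_space \<Rightarrow> ('h \<Rightarrow> 'h) \<Rightarrow> bool" where
  "bounded_operator H T \<longleftrightarrow> (let V = vec_carrier H in
     (\<forall>x\<in>V. T x \<in> V) \<and>
     (\<forall>x\<in>V. \<forall>y\<in>V. T (vec_add H x y) = vec_add H (T x) (T y)) \<and>
     (\<forall>c. \<forall>x\<in>V. T (vec_scale H c x) = vec_scale H c (T x)) \<and>
     (\<exists>K. \<forall>x\<in>V. vec_norm H (T x) \<le> K * vec_norm H x))"

definition operator_norm :: "'h inner_space \<Rightarrow> ('h \<Rightarrow> 'h) \<Rightarrow> real" where
  "operator_norm H T = Sup {vec_norm H (T x) | x. x \<in> vec_carrier H \<and> vec_norm H x \<le> 1}"

definition star_representation ::
    "('a, 'c) star_algebra_scheme \<Rightarrow> 'h inner_space \<Rightarrow> ('a \<Rightarrow> 'h \<Rightarrow> 'h) \<Rightarrow> bool" where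
  "star_representation R H \<pi> \<longleftrightarrow> hilbert_space H \<and> (let V = vec_carrier H; C = alg_carrier R in
     (\<forall>a\<in>C. bounded_operator H (\<pi> a)) \<and>
     (\<forall>a\<in>C. \<forall>b\<in>C. \<forall>x\<in>V. \<pi> (alg_add R a b) x = vec_add H (\<pi> a x) (\<pi> b x)) \<and>
     (\<forall>c. \<forall>a\<in>C. \<forall>x\<in>V. \<pi> (alg_scale R c a) x = vec_scale H c (\<pi> a x)) \<and>
     (\<forall>a\<in>C. \<forall>b\<in>C. \<forall>x\<in>V. \<pi> (alg_mult R a b) x = \<pi> a (\<pi> b x)) \<and>
     (\<forall>a\<in>C. \<forall>x\<in>V. \<forall>y\<in>V. vec_inner H (\<pi> (alg_star R a) x) y = vec_inner H x (\<pi> a y)))"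

text \<open>The supremum of the norms over all representations on Hilbert spaces. HOL needs one type for
  the vectors. With vectors in \<^typ>\<open>'a \<Rightarrow> complex\<close> nothing is lost: the same supremum is obtained from
  the cyclic representations, and in a representation \<open>\<pi>\<close> with cyclic vector \<open>\<xi>\<close> a vector \<open>v\<close> is
  determined by the function \<open>\<lambda>a. \<langle>\<pi> a \<xi>, v\<rangle>\<close>, so the space can be transported
  to a subset of this type.\<close>

definition full_norm :: "('a, 'c) star_algebra_scheme \<Rightarrow> 'a \<Rightarrow> real" where
  "full_norm R a =
     Sup {operator_norm H (\<pi> a) | (H :: ('a \<Rightarrow> complex) inner_space) \<pi>. star_representation R H \<pi>}"

section \<open>Completion\<close>

definition alg_dist :: "'a normed_star_algebra \<Rightarrow> 'a \<Rightarrow> 'a \<Rightarrow> real" where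
  "alg_dist R a b = alg_norm R (alg_add R a (alg_scale R (-1) b))"

definition cauchy_seqs :: "'a normed_star_algebra \<Rightarrow> (nat \<Rightarrow> 'a) set" where
  "cauchy_seqs R = {X. (\<forall>n. X n \<in> alg_carrier R) \<and>
     (\<forall>e>0. \<exists>N. \<forall>m\<ge>N. \<forall>n\<ge>N. alg_dist R (X m) (X n) < e)}"

definition seq_class :: "'a normed_star_algebra \<Rightarrow> (nat \<Rightarrow> 'a) \<Rightarrow> (nat \<Rightarrow> 'a) set" where
  "seq_class R X = {Y \<in> cauchy_seqs R. (\<lambda>n. alg_dist R (X n) (Y n)) \<longlonglongrightarrow> 0}"

text \<open>Elements are classes of Cauchy sequences modulo null sequences. The operations are
  independent of the chosen representatives, so all the sets united below
  coincide.\<close>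

definition completion :: "'a normed_star_algebra \<Rightarrow> (nat \<Rightarrow> 'a) set normed_star_algebra" where
  "completion R =
     \<lparr> alg_carrier = seq_class R ` cauchy_seqs R,
       alg_add = (\<lambda>P Q. \<Union>X\<in>P. \<Union>Y\<in>Q. seq_class R (\<lambda>n. alg_add R (X n) (Y n))),
       alg_scale = (\<lambda>c P. \<Union>X\<in>P. seq_class R (\<lambda>n. alg_scale R c (X n))),
       alg_mult = (\<lambda>P Q. \<Union>X\<in>P. \<Union>Y\<in>Q. seq_class R (\<lambda>n. alg_mult R (X n) (Y n))),
       alg_star = (\<lambda>P. \<Union>X\<in>P. seq_class R (\<lambda>n. alg_star R (X n))),
       alg_norm = (\<lambda>P. lim (\<lambda>n. alg_norm R ((SOME X. X \<in> P) n))) \<rparr>"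

section \<open>The groupoid algebra of a Hausdorff etale groupoid\<close>

text \<open>Functions on the arrows are extended by zero.\<close>

definition compactly_supported :: "'g topological_groupoid \<Rightarrow> ('g \<Rightarrow> complex) set" where
  "compactly_supported G = {f. (\<forall>\<gamma>. \<gamma> \<notin> arrows G \<longrightarrow> f \<gamma> = 0) \<and>
     continuous_map (arrow_topology G) euclidean f \<and>
     compactin (arrow_topology G) (arrow_topology G closure_of {\<gamma> \<in> arrows G. f \<gamma> \<noteq> 0})}"

text \<open>For compactly supported functions on an etale groupoid the sum has only finitely many
  nonzero terms; the index set itself may be infinite, hence \<open>infsum\<close>.\<close>

definition convolution ::
    "'g topological_groupoid \<Rightarrow> ('g \<Rightarrow> complex) \<Rightarrow> ('g \<Rightarrow> complex) \<Rightarrow> 'g \<Rightarrow> complex" where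
  "convolution G f g \<gamma> = (if \<gamma> \<in> arrows G then
     (\<Sum>\<^sub>\<infinity>(\<alpha>, \<beta>) \<in> {(\<alpha>, \<beta>). \<alpha> \<in> arrows G \<and> \<beta> \<in> arrows G \<and> src G \<alpha> = rng G \<beta> \<and> mult G \<alpha> \<beta> = \<gamma>}.
        f \<alpha> * g \<beta>) else 0)"

definition convolution_algebra :: "'g topological_groupoid \<Rightarrow> ('g \<Rightarrow> complex) star_algebra" where
  "convolution_algebra G =
     \<lparr> alg_carrier = compactly_supported G,
       alg_add = (\<lambda>f g \<gamma>. f \<gamma> + g \<gamma>),
       alg_scale = (\<lambda>c f \<gamma>. c * f \<gamma>),
       alg_mult = convolution G,
       alg_star = (\<lambda>f \<gamma>. if \<gamma> \<in> arrows G then cnj (f (inverse_arrow G \<gamma>)) else 0) \<rparr>"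

definition groupoid_cstar ::
    "'g topological_groupoid \<Rightarrow> (nat \<Rightarrow> 'g \<Rightarrow> complex) set normed_star_algebra" where
  "groupoid_cstar G = completion
     (star_algebra.extend (convolution_algebra G)
        (normed_star_algebra.fields (full_norm (convolution_algebra G))))"

end

theory Submission
  imports Defs
begin

text \<open>Expansivity of \<open>A\<close> on the torus identifies \<open>G\<^sub>A\<^sup>a\<close> with the set of pairs \<open>(q x, q z)\<close> such that
  \<open>q z\<close> lies both on the \<open>v\<^sub>s\<close>-line and on the \<open>v\<^sub>u\<close>-line through \<open>q x\<close>; the filtration \<open>G\<^sub>n\<close> bounds the
  displacements along the lines by \<open>\<epsilon> |\<lambda>\<^sub>u|\<^sup>n\<close>, since \<open>|\<lambda>\<^sub>s \<lambda>\<^sub>u| = 1\<close>. So the topological groupoid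
  depends only on the unordered pair of eigenlines: cofinal filtrations give the same inductive limit
  topology. As \<open>B\<close> commutes with \<open>A\<close>, it preserves the eigenlines of \<open>A\<close>, and its eigenvalues on them
  differ, for otherwise \<open>B\<close> would be a scalar \<open>\<beta>\<close> with \<open>\<beta>\<^sup>2 = 1\<close>. Hence \<open>A\<close> and \<open>B\<close> have the same
  pair of eigenlines, possibly with stable and unstable interchanged.\<close>

section \<open>Eigenvectors of two by two matrices\<close>

lemma of_int_matrix_mult:
  "map_matrix of_int (A ** B) = (map_matrix of_int A ** map_matrix of_int B :: 'a::ring_1^'k^'n)"
  by (simp add: vec_eq_iff map_matrix_def matrix_matrix_mult_def)

lemma of_int_matrix_id: "map_matrix of_int (mat 1) = (mat 1 :: 'a::ring_1^'n^'n)"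
  by (simp add: vec_eq_iff map_matrix_def mat_def)

lemma mat_vector_mult: "mat l *v v = (l::'a::comm_semiring_1) *s v"
  by (simp add: vec_eq_iff matrix_vector_mult_def mat_def if_distrib[of "\<lambda>c. c * _"] cong: if_cong)

text \<open>An eigenvector is a nonzero kernel vector of \<open>M - mat l\<close>, so it exists
  exactly when the determinant vanishes. The field is general because hyperbolicity concerns complex
  eigenvalues, while the stable and unstable eigenvalues are taken over the reals.\<close>

lemma eigenvalue_iff_char_poly:
  fixes M :: "'a::field^2^2"
  shows "(\<exists>v. eigenpair M l v) \<longleftrightarrow> l\<^sup>2 - trace M * l + det M = 0"
proof -
  have "(\<exists>v. eigenpair M l v) \<longleftrightarrow> (\<exists>v. v \<noteq> 0 \<and> (M - mat l) *v v = 0)"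
    by (simp add: eigenpair_def matrix_vector_mult_diff_rdistrib mat_vector_mult)
  also have "\<dots> \<longleftrightarrow> det (M - mat l) = 0"
    using matrix_left_invertible_ker[of "M - mat l"] invertible_left_inverse[of "M - mat l"]
      invertible_det_nz[of "M - mat l"] by blast
  also have "det (M - mat l) = l\<^sup>2 - trace M * l + det M"
    by (simp add: det_2 trace_def sum_2 mat_def power2_eq_square algebra_simps)
  finally show ?thesis .
qed

lemma eigenpair_scaleR:
  fixes M :: "real^'n^'n"
  assumes "eigenpair M l v" and "c \<noteq> 0"
  shows "eigenpair M l (c *\<^sub>R v)"
  using assms by (simp add: eigenpair_def matrix_vector_mult_scaleR scalar_mult_eq_scaleR)

lemma eigenpairs_span_plane:
  fixes M :: "real^2^2"
  assumes v: "eigenpair M l v" and w: "eigenpair M m w" and lm: "l \<noteq> m"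
  shows "\<exists>a b. x = a *\<^sub>R v + b *\<^sub>R w"
proof -
  define D where "D = v$1 * w$2 - v$2 * w$1"
  have "D \<noteq> 0"
  proof
    assume "D = 0"
    \<comment> \<open>Proportionality of \<open>v\<close> and \<open>w\<close> without division;
      applying \<open>M\<close> turns it into a relation with factor \<open>l - m\<close>.\<close>
    then have par: "w$i *\<^sub>R v = v$i *\<^sub>R w" for i
      using exhaust_2[of i] by (auto simp: vec_eq_iff forall_2 D_def mult.commute)
    have "w$i = 0" for i
    proof -
      have "M *v (w$i *\<^sub>R v) = M *v (v$i *\<^sub>R w)" by (simp only: par)
      then have "l *\<^sub>R (w$i *\<^sub>R v) = m *\<^sub>R (v$i *\<^sub>R w)"
        using v w by (simp add: eigenpair_def matrix_vector_mult_scaleR scalar_mult_eq_scaleR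
            mult.commute)
      then have "(l - m) *\<^sub>R (w$i *\<^sub>R v) = 0"
        by (simp only: par[symmetric] scaleR_left_diff_distrib) simp
      then show "w$i = 0" using v lm by (simp add: eigenpair_def)
    qed
    then show False using w by (simp add: eigenpair_def vec_eq_iff)
  qed
  \<comment> \<open>Coefficients by Cramer's rule.\<close>
  then have "x = ((x$1 * w$2 - x$2 * w$1) / D) *\<^sub>R v + ((v$1 * x$2 - v$2 * x$1) / D) *\<^sub>R w"
    by (simp add: vec_eq_iff forall_2 field_simps) (simp add: D_def algebra_simps)
  then show ?thesis by blast
qed

text \<open>In the expansion of \<open>x\<close> along \<open>v\<close> and \<open>w\<close>, the
  eigenvalue equation leaves \<open>m - l\<close> times the \<open>w\<close>-part equal to zero. The
  hypothesis on \<open>x\<close> admits \<open>x = 0\<close>, so it can be applied to an image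
  vector not yet known to be nonzero.\<close>

lemma eigenpair_multiple:
  fixes M :: "real^2^2"
  assumes v: "eigenpair M l v" and w: "eigenpair M m w" and lm: "l \<noteq> m" and x: "M *v x = l *\<^sub>R x"
  shows "\<exists>a. x = a *\<^sub>R v"
proof -
  obtain a b where ab: "x = a *\<^sub>R v + b *\<^sub>R w" using eigenpairs_span_plane[OF v w lm] by blast
  have "M *v x = l *\<^sub>R (a *\<^sub>R v) + m *\<^sub>R (b *\<^sub>R w)"
    using v w by (simp add: ab eigenpair_def matrix_vector_right_distrib matrix_vector_mult_scaleR
        scalar_mult_eq_scaleR mult.commute)
  then have "(m - l) *\<^sub>R (b *\<^sub>R w) = 0"
    using x by (auto simp add: ab scaleR_left_diff_distrib scaleR_right_distrib)
  then have "b = 0" using w lm by (auto simp: eigenpair_def)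
  then show ?thesis using ab by auto
qed

text \<open>Unit eigenvectors picked by \<open>SOME\<close> are determined only up to this
  sign.\<close>

lemma unit_eigenpairs_eq_or_neg:
  fixes M :: "real^2^2"
  assumes "eigenpair M l v" and "eigenpair M m w" and "l \<noteq> m" and "eigenpair M l x"
    and "norm v = 1" and "norm x = 1"
  shows "x = v \<or> x = - v"
proof -
  obtain a where a: "x = a *\<^sub>R v"
    using eigenpair_multiple[OF assms(1-3), of x] assms(4)
    by (auto simp: eigenpair_def scalar_mult_eq_scaleR)
  then have "\<bar>a\<bar> = 1" using assms by simp
  then have "a = 1 \<or> a = -1" by arith
  then show ?thesis using a by auto
qed

section \<open>Eigenvalues of hyperbolic integer matrices\<close>

text \<open>The determinant is a unit of the integers.\<close>

lemma invertible_int_det: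
  fixes A :: "int^'n^'n"
  assumes "invertible A"
  shows "\<bar>det A\<bar> = 1"
proof -
  obtain A' where "A ** A' = mat 1" using assms by (auto simp: invertible_def)
  then have "det A * det A' = 1" by (metis det_mul det_I)
  then show ?thesis using zmult_eq_1_iff by fastforce
qed

lemma det_of_int_matrix: "det (map_matrix of_int A :: 'a::comm_ring_1^'n^'n) = of_int (det A)"
  by (simp add: det_def map_matrix_def)

lemma trace_of_int_matrix: "trace (map_matrix of_int A :: 'a::comm_ring_1^'n^'n) = of_int (trace A)"
  by (simp add: trace_def map_matrix_def)

text \<open>The roots of the characteristic polynomial have product \<open>det A\<close>, which is 1
  or -1. A nonreal conjugate pair would have modulus 1, so the roots are real, and their moduli are
  reciprocal and different from 1.\<close>

lemma hyperbolic_spectrum: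
  assumes "invertible A" and "hyperbolic A"
  obtains l m where "\<bar>l\<bar> < 1" and "\<bar>m\<bar> > 1" and "\<bar>l\<bar> * \<bar>m\<bar> = 1"
    and "\<And>x. (\<exists>v. eigenpair (real_matrix A) x v) \<longleftrightarrow> x = l \<or> x = m"
proof -
  define d where "d = det A"
  define t where "t = trace A"
  note of_int = det_of_int_matrix[of A, folded d_def] trace_of_int_matrix[of A, folded t_def]
  have d: "d = 1 \<or> d = -1"
    using invertible_int_det[OF assms(1)] by (auto simp: d_def)
  have real_eig: "(\<exists>v. eigenpair (real_matrix A) x v) \<longleftrightarrow> x\<^sup>2 - t * x + d = 0" for x :: real
    by (simp add: eigenvalue_iff_char_poly of_int)
  have unimod: "x\<^sup>2 - of_int t * x + of_int d \<noteq> 0" if "cmod x = 1" for x :: complex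
    using assms(2) that unfolding hyperbolic_def
    by (metis eigenvalue_iff_char_poly of_int)
  define q :: real where "q = (real_of_int t)\<^sup>2 - 4 * d"
  have "q \<ge> 0"
  proof (rule ccontr)
    assume "\<not> q \<ge> 0"
    then have q: "q < 0" by simp
    \<comment> \<open>A negative discriminant means \<open>4 * d > t^2\<close>, which excludes
      \<open>d = -1\<close>.\<close>
    then have d1: "d = 1"
      using d zero_le_power2[of "real_of_int t"] by (auto simp: q_def simp del: zero_le_power2)
    \<comment> \<open>The root with positive imaginary part; its squared modulus is
      \<open>d = 1\<close>.\<close>
    define x where "x = Complex (t / 2) (sqrt (- q) / 2)"
    have "(sqrt (- q))\<^sup>2 = - q" using q by simp
    then have sq: "(sqrt (- q) / 2)\<^sup>2 = 1 - (t / 2)\<^sup>2"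
      by (simp add: q_def d1 power_divide field_simps)
    have "cmod x = 1" by (simp add: x_def cmod_def sq)
    moreover have "x\<^sup>2 - of_int t * x + of_int d = 0"
      using sq by (simp add: x_def d1 complex_eq_iff power2_eq_square field_simps)
    ultimately show False using unimod by blast
  qed
  define l where "l = (t + sqrt q) / 2"
  define m where "m = (t - sqrt q) / 2"
  have "sqrt q * sqrt q = q" using \<open>q \<ge> 0\<close> by simp
  then have lm: "l * m = d" by (simp add: l_def m_def q_def power2_eq_square field_simps)
  have sum: "l + m = t" by (simp add: l_def m_def field_simps)
  have factor: "x\<^sup>2 - t * x + d = (x - l) * (x - m)" for x :: real
    by (simp add: power2_eq_square algebra_simps flip: lm sum)
  have eig: "(\<exists>v. eigenpair (real_matrix A) x v) \<longleftrightarrow> x = l \<or> x = m" for x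
    by (simp add: real_eig factor)
  have "\<bar>x\<bar> \<noteq> 1" if "x = l \<or> x = m" for x
  proof
    assume "\<bar>x\<bar> = 1"
    then have "cmod (of_real x) = 1" by simp
    from unimod[OF this] have "complex_of_real (x\<^sup>2 - t * x + d) \<noteq> 0" by simp
    then show False using that by (subst (asm) factor) auto
  qed
  then have ne: "\<bar>l\<bar> \<noteq> 1" "\<bar>m\<bar> \<noteq> 1" by auto
  have abs1: "\<bar>l\<bar> * \<bar>m\<bar> = 1" using lm d by (auto simp flip: abs_mult)
  \<comment> \<open>The labels \<open>l\<close> and \<open>m\<close> follow the sign of the square
    root, not the size, so the second case exchanges them.\<close>
  show thesis
  proof (cases "\<bar>l\<bar> < 1")
    case True
    then have "\<bar>m\<bar> > 1"
      using abs1 ne mult_le_one[of "\<bar>l\<bar>" "\<bar>m\<bar>"]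
      by (smt (verit) mult_left_le mult_nonneg_nonneg)
    then show thesis using that[of l m] True abs1 eig by blast
  next
    case False
    then have "\<bar>l\<bar> > 1" using ne by simp
    moreover have "\<bar>m\<bar> < 1"
      using abs1 ne \<open>\<bar>l\<bar> > 1\<close> by (smt (verit) mult_less_cancel_right1)
    ultimately show thesis using that[of m l] abs1 eig by (simp add: mult.commute disj_commute)
  qed
qed

text \<open>Exactly one eigenvalue lies on each side of modulus 1, so the \<open>THE\<close> terms
  denote, and rescaling an eigenvector provides a witness for \<open>SOME\<close>. Later arguments
  use only these facts about the chosen eigendata.\<close>

lemma hyperbolic_eigenpairs:
  assumes "invertible A" and "hyperbolic A"
  shows "eigenpair (real_matrix A) (stable_eigenvalue A) (stable_vector A)"
    and "eigenpair (real_matrix A) (unstable_eigenvalue A) (unstable_vector A)"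
    and "norm (stable_vector A) = 1" and "norm (unstable_vector A) = 1"
    and "\<bar>stable_eigenvalue A\<bar> < 1" and "\<bar>unstable_eigenvalue A\<bar> > 1"
    and "\<bar>stable_eigenvalue A\<bar> * \<bar>unstable_eigenvalue A\<bar> = 1"
    and "eigenpair (real_matrix A) x v \<Longrightarrow> x = stable_eigenvalue A \<or> x = unstable_eigenvalue A"
proof -
  obtain l m where lm: "\<bar>l\<bar> < 1" "\<bar>m\<bar> > 1" "\<bar>l\<bar> * \<bar>m\<bar> = 1"
    and eig: "\<And>x. (\<exists>v. eigenpair (real_matrix A) x v) \<longleftrightarrow> x = l \<or> x = m"
    using hyperbolic_spectrum[OF assms] by blast
  have l: "stable_eigenvalue A = l"
    unfolding stable_eigenvalue_def eig using lm by (intro the_equality) auto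
  have m: "unstable_eigenvalue A = m"
    unfolding unstable_eigenvalue_def eig using lm by (intro the_equality) auto
  have unit: "\<exists>v. eigenpair (real_matrix A) x v \<and> norm v = 1" if x: "x = l \<or> x = m" for x
  proof -
    obtain v where v: "eigenpair (real_matrix A) x v" using eig x by blast
    then have "v \<noteq> 0" by (simp add: eigenpair_def)
    then show ?thesis
      using eigenpair_scaleR[OF v, of "inverse (norm v)"] by (intro exI[of _ "inverse (norm v) *\<^sub>R v"]) simp
  qed
  show "eigenpair (real_matrix A) (stable_eigenvalue A) (stable_vector A)"
    and "norm (stable_vector A) = 1"
    using someI_ex[OF unit[of l]] by (auto simp: stable_vector_def l)
  show "eigenpair (real_matrix A) (unstable_eigenvalue A) (unstable_vector A)"
    and "norm (unstable_vector A) = 1"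
    using someI_ex[OF unit[of m]] by (auto simp: unstable_vector_def m)
  show "\<bar>stable_eigenvalue A\<bar> < 1" "\<bar>unstable_eigenvalue A\<bar> > 1"
    "\<bar>stable_eigenvalue A\<bar> * \<bar>unstable_eigenvalue A\<bar> = 1"
    using lm by (auto simp: l m)
  show "eigenpair (real_matrix A) x v \<Longrightarrow> x = stable_eigenvalue A \<or> x = unstable_eigenvalue A"
    using eig l m by blast
qed

text \<open>The second alternative does occur: the inverse of \<open>A\<close> commutes with
  \<open>A\<close> and has its stable and unstable lines interchanged.\<close>

lemma commuting_hyperbolic_eigenvectors:
  assumes A: "invertible A" "hyperbolic A" and B: "invertible B" "hyperbolic B"
    and comm: "A ** B = B ** A"
  obtains
    "stable_vector B = stable_vector A \<or> stable_vector B = - stable_vector A"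
    "unstable_vector B = unstable_vector A \<or> unstable_vector B = - unstable_vector A"
  | "stable_vector B = unstable_vector A \<or> stable_vector B = - unstable_vector A"
    "unstable_vector B = stable_vector A \<or> unstable_vector B = - stable_vector A"
proof -
  let ?A = "real_matrix A" and ?B = "real_matrix B"
  let ?s = "stable_vector A" and ?u = "unstable_vector A"
  note hA = hyperbolic_eigenpairs[OF A] and hB = hyperbolic_eigenpairs[OF B]
  have neA: "stable_eigenvalue A \<noteq> unstable_eigenvalue A" using hA(5,6) by auto
  have neB: "stable_eigenvalue B \<noteq> unstable_eigenvalue B" using hB(5,6) by auto
  have AB: "?A *v (?B *v x) = ?B *v (?A *v x)" for x
    by (simp add: matrix_vector_mul_assoc comm flip: of_int_matrix_mult)
  have inv: "?A *v (?B *v x) = l *\<^sub>R (?B *v x)" if "eigenpair ?A l x" for l x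
    using that by (simp add: AB eigenpair_def matrix_vector_mult_scaleR scalar_mult_eq_scaleR)
  obtain b where "?B *v ?s = b *\<^sub>R ?s"
    using eigenpair_multiple[OF hA(1,2) neA inv[OF hA(1)]] by blast
  then have b: "eigenpair ?B b ?s" using hA(1) by (simp add: eigenpair_def scalar_mult_eq_scaleR)
  obtain c where "?B *v ?u = c *\<^sub>R ?u"
    using eigenpair_multiple[OF hA(2,1) neA[symmetric] inv[OF hA(2)]] by blast
  then have c: "eigenpair ?B c ?u" using hA(2) by (simp add: eigenpair_def scalar_mult_eq_scaleR)
  have "b \<noteq> c"
  proof
    assume "b = c"
    \<comment> \<open>With \<open>b = c\<close> the matrix \<open>?B\<close> acts as the scalar
      \<open>b\<close> on a spanning pair, so it cannot have two distinct eigenvalues.\<close>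
    have "x = b" if x: "eigenpair ?B x v" for x v
    proof -
      obtain p q where v: "v = p *\<^sub>R ?s + q *\<^sub>R ?u" using eigenpairs_span_plane[OF hA(1,2) neA] by blast
      have "?B *v v = b *\<^sub>R v"
        using b c \<open>b = c\<close>
        by (simp add: v eigenpair_def matrix_vector_right_distrib matrix_vector_mult_scaleR
            scalar_mult_eq_scaleR scaleR_right_distrib mult.commute)
      then show ?thesis using x by (auto simp: eigenpair_def scalar_mult_eq_scaleR)
    qed
    then show False using hB(1,2) neB by metis
  qed
  with hB(8)[OF b] hB(8)[OF c] consider
    "b = stable_eigenvalue B" "c = unstable_eigenvalue B" |
    "b = unstable_eigenvalue B" "c = stable_eigenvalue B" by blast
  then show thesis
  proof cases
    case 1
    show thesis
      using unit_eigenpairs_eq_or_neg[OF b c \<open>b \<noteq> c\<close>, of "stable_vector B"]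
        unit_eigenpairs_eq_or_neg[OF c b \<open>b \<noteq> c\<close>[symmetric], of "unstable_vector B"]
        hA(1-4) hB(1-4) 1 by (intro that(1)) auto
  next
    case 2
    show thesis
      using unit_eigenpairs_eq_or_neg[OF b c \<open>b \<noteq> c\<close>, of "unstable_vector B"]
        unit_eigenpairs_eq_or_neg[OF c b \<open>b \<noteq> c\<close>[symmetric], of "stable_vector B"]
        hA(1-4) hB(1-4) 2 by (intro that(2)) auto
  qed
qed

section \<open>Asymptotic points on the torus\<close>

lemma dist_torus_proj_le: "dist (torus_proj z) (torus_proj w) \<le> norm (z - w)"
  unfolding dist_torus_def by (rule cInf_lower) (auto intro: bdd_belowI[of _ 0])

text \<open>Lifts a small torus distance to a short vector \<open>w\<close> that represents the
  displacement modulo the lattice. The strict bound makes attainment of the infimum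
  irrelevant.\<close>

lemma dist_torus_proj_less:
  assumes "dist (torus_proj x) (torus_proj y) < e"
  obtains w where "integer_vector (x - y - w)" and "norm w < e"
proof -
  have "{norm (z - w) | z w. torus_proj z = torus_proj x \<and> torus_proj w = torus_proj y} \<noteq> {}"
    by blast
  from cInf_lessD[OF this assms[unfolded dist_torus_def]]
  obtain z w where zw: "torus_proj z = torus_proj x" "torus_proj w = torus_proj y" "norm (z - w) < e"
    by auto
  then have "integer_vector (w - y)" "integer_vector (z - x)" by (simp_all flip: torus_proj_eq_iff)
  then have "integer_vector ((w - y) - (z - x))" by (rule integer_vector_diff)
  then have "integer_vector (x - y - (z - w))" by (simp add: algebra_simps)
  then show thesis using that zw(3) by blast
qed

lemma integer_vector_norm_less_1:
  assumes "integer_vector v" and "norm v < 1"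
  shows "v = 0"
proof -
  have "\<bar>v $ i\<bar> < 1" for i
    using assms(2) by (metis component_le_norm_cart order_le_less_trans)
  then have "v $ i = 0" for i
    using assms(1) Ints_nonzero_abs_less1 unfolding integer_vector_def by blast
  then show ?thesis by (simp add: vec_eq_iff)
qed

text \<open>Well-definedness of \<open>torus_map\<close>, applied to the classes of \<open>v\<close>
  and 0.\<close>

lemma integer_vector_matrix_mult:
  assumes "integer_vector v"
  shows "integer_vector (real_matrix A *v v)"
  using assms torus_map_proj[of A v] torus_map_proj[of A 0]
  by (metis diff_zero matrix_vector_mult_0_right torus_proj_eq_iff)

lemma torus_map_funpow_proj:
  "(torus_map A ^^ n) (torus_proj v) = torus_proj (((*v) (real_matrix A) ^^ n) v)"
  by (induction n) (simp_all add: torus_map_proj)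

lemma torus_map_mult: "torus_map (A ** B) x = torus_map A (torus_map B x)"
proof -
  obtain v where "x = torus_proj v" using torus_proj_surj by metis
  then show ?thesis
    by (simp add: torus_map_proj of_int_matrix_mult matrix_vector_mul_assoc)
qed

lemma torus_map_id: "torus_map (mat 1) x = x"
proof -
  obtain v where "x = torus_proj v" using torus_proj_surj by metis
  then show ?thesis by (simp add: torus_map_proj of_int_matrix_id)
qed

lemma funpow_matrix_eigen_combination:
  fixes M :: "real^'n^'n"
  assumes "eigenpair M l v" and "eigenpair M m w"
  shows "((*v) M ^^ k) (a *\<^sub>R v + b *\<^sub>R w) = (a * l ^ k) *\<^sub>R v + (b * m ^ k) *\<^sub>R w"
  using assms
  by (induction k) (simp_all add: eigenpair_def matrix_vector_right_distrib
      matrix_vector_mult_scaleR scalar_mult_eq_scaleR mult_ac)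

lemma funpow_matrix_add:
  fixes M :: "'a::comm_ring_1^'n^'n"
  shows "((*v) M ^^ k) (x + y) = ((*v) M ^^ k) x + ((*v) M ^^ k) y"
  by (induction k) (simp_all add: matrix_vector_right_distrib)

text \<open>The \<open>w\<close>-component grows like \<open>\<bar>m\<bar> ^ k\<close> while the
  \<open>v\<close>-component stays bounded, so a bounded forward orbit has no
  \<open>w\<close>-component.\<close>

lemma eigen_orbit_bounded_imp_stable:
  fixes M :: "real^'n^'n"
  assumes v: "eigenpair M l v" and w: "eigenpair M m w" and l: "\<bar>l\<bar> < 1" and m: "\<bar>m\<bar> > 1"
    and bound: "\<And>k. norm (((*v) M ^^ k) (a *\<^sub>R v + b *\<^sub>R w)) \<le> e"
  shows "b = 0"
proof (rule ccontr)
  assume "b \<noteq> 0"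
  have pos: "\<bar>b\<bar> * norm w > 0" using \<open>b \<noteq> 0\<close> w by (simp add: eigenpair_def)
  obtain k where k: "(e + \<bar>a\<bar> * norm v) / (\<bar>b\<bar> * norm w) < \<bar>m\<bar> ^ k"
    using real_arch_pow[OF m] by blast
  have "\<bar>m\<bar> ^ k * (\<bar>b\<bar> * norm w) = norm ((b * m ^ k) *\<^sub>R w)"
    by (simp add: abs_mult power_abs)
  also have "(b * m ^ k) *\<^sub>R w = ((*v) M ^^ k) (a *\<^sub>R v + b *\<^sub>R w) - (a * l ^ k) *\<^sub>R v"
    by (simp add: funpow_matrix_eigen_combination[OF v w])
  also have "norm \<dots> \<le> e + norm ((a * l ^ k) *\<^sub>R v)"
    using norm_triangle_ineq4 bound[of k] by (smt (verit))
  also have "norm ((a * l ^ k) *\<^sub>R v) \<le> \<bar>a\<bar> * norm v"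
  proof -
    have "\<bar>l\<bar> ^ k \<le> 1" using l by (simp add: power_le_one)
    then have "\<bar>a\<bar> * norm v * \<bar>l\<bar> ^ k \<le> \<bar>a\<bar> * norm v" by (intro mult_left_le) auto
    then show ?thesis by (simp add: abs_mult power_abs mult_ac)
  qed
  finally have "\<bar>m\<bar> ^ k * (\<bar>b\<bar> * norm w) \<le> e + \<bar>a\<bar> * norm v" by simp
  then show False using k pos by (simp add: divide_less_eq)
qed

text \<open>Moving along \<open>v\<close> is contracted by the factor \<open>l\<close>. Conversely,
  expansivity yields a displacement along \<open>v\<close> at some late time \<open>N\<close>, and
  injectivity of the torus map carries it back to time 0. Stated for arbitrary eigendata so that it
  also serves the inverse matrix.\<close>

lemma forward_asymptotic_iff:
  assumes v: "eigenpair (real_matrix A) l v" and w: "eigenpair (real_matrix A) m w"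
    and l: "\<bar>l\<bar> < 1" "l \<noteq> 0" and m: "\<bar>m\<bar> > 1" and inj: "inj (torus_map A)"
  shows "(\<lambda>n. dist ((torus_map A ^^ n) (torus_proj x)) ((torus_map A ^^ n) (torus_proj z)))
      \<longlonglongrightarrow> 0 \<longleftrightarrow> (\<exists>s. torus_proj z = torus_proj (x + s *\<^sub>R v))"
proof
  let ?M = "real_matrix A" and ?T = "torus_map A"
  assume "\<exists>s. torus_proj z = torus_proj (x + s *\<^sub>R v)"
  then obtain s where s: "torus_proj z = torus_proj (x + s *\<^sub>R v)" by blast
  have "dist ((?T ^^ n) (torus_proj x)) ((?T ^^ n) (torus_proj z)) \<le> \<bar>l\<bar> ^ n * norm (s *\<^sub>R v)" for n
    using dist_torus_proj_le[of "((*v) ?M ^^ n) x" "((*v) ?M ^^ n) x + (s * l ^ n) *\<^sub>R v"]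
      funpow_matrix_eigen_combination[OF v w, of n s 0]
    by (simp add: s torus_map_funpow_proj funpow_matrix_add abs_mult power_abs mult_ac)
  moreover have "(\<lambda>n. \<bar>l\<bar> ^ n * norm (s *\<^sub>R v)) \<longlonglongrightarrow> 0"
    using l by (intro tendsto_mult_left_zero LIMSEQ_power_zero) simp
  ultimately show "(\<lambda>n. dist ((?T ^^ n) (torus_proj x)) ((?T ^^ n) (torus_proj z))) \<longlonglongrightarrow> 0"
    by (rule_tac tendsto_sandwich[of "\<lambda>_. 0"]) auto
next
  let ?M = "real_matrix A" and ?T = "torus_map A"
  assume lim: "(\<lambda>n. dist ((?T ^^ n) (torus_proj x)) ((?T ^^ n) (torus_proj z))) \<longlonglongrightarrow> 0"
  obtain K where K: "K > 0" "\<And>y. norm (?M *v y) \<le> norm y * K"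
    using bounded_linear.pos_bounded[OF matrix_vector_mul_bounded_linear[of ?M]] by blast
  \<comment> \<open>Chosen so that \<open>e * K + e = 1\<close>: if \<open>norm y\<close> and
    \<open>norm y'\<close> are below \<open>e\<close>, then \<open>?M *v y - y'\<close> has norm
    below 1.\<close>
  define e where "e = 1 / (K + 1)"
  have e: "e > 0" "e * K + e = 1" using K(1) by (auto simp: e_def field_simps)
  obtain N where N: "dist ((?T ^^ n) (torus_proj x)) ((?T ^^ n) (torus_proj z)) < e" if "n \<ge> N" for n
    using LIMSEQ_D[OF lim e(1)] by auto
  have "\<exists>y. integer_vector (((*v) ?M ^^ n) z - ((*v) ?M ^^ n) x - y) \<and> norm y < e" if "n \<ge> N" for n
    using N[OF that] dist_torus_proj_less[of "((*v) ?M ^^ n) z" "((*v) ?M ^^ n) x" e]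
    by (auto simp: torus_map_funpow_proj dist_commute)
  then obtain y where y: "integer_vector (((*v) ?M ^^ n) z - ((*v) ?M ^^ n) x - y n)"
    "norm (y n) < e" if "n \<ge> N" for n by metis
  \<comment> \<open>Expansivity: the short displacements \<open>y n\<close> form an exact orbit, because
    \<open>?M *v y n - y (Suc n)\<close> is an integer vector of norm less than 1.\<close>
  have step: "?M *v y n = y (Suc n)" if n: "n \<ge> N" for n
  proof -
    have "integer_vector ((((*v) ?M ^^ Suc n) z - ((*v) ?M ^^ Suc n) x - y (Suc n))
        - ?M *v (((*v) ?M ^^ n) z - ((*v) ?M ^^ n) x - y n))"
      using n by (intro integer_vector_diff integer_vector_matrix_mult y) auto
    then have "integer_vector (?M *v y n - y (Suc n))"
      by (simp add: matrix_vector_mult_diff_distrib)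
    moreover have "norm (?M *v y n - y (Suc n)) < 1"
    proof -
      have "norm (y n) * K < e * K" using y(2)[OF n] K(1) by simp
      then show ?thesis
        using norm_triangle_ineq4[of "?M *v y n" "y (Suc n)"] K(2)[of "y n"] y(2)[of "Suc n"] n e
        by linarith
    qed
    ultimately show ?thesis using integer_vector_norm_less_1 by fastforce
  qed
  have orbit: "((*v) ?M ^^ k) (y N) = y (N + k)" for k
    by (induction k) (simp_all add: step)
  obtain a b where ab: "y N = a *\<^sub>R v + b *\<^sub>R w"
    using eigenpairs_span_plane[OF v w] l m by fastforce
  \<comment> \<open>The forward orbit of \<open>y N\<close> consists of later \<open>y n\<close>,
    all shorter than \<open>e\<close>.\<close>
  have "b = 0"
    using y(2) orbit by (intro eigen_orbit_bounded_imp_stable[OF v w l(1) m, of a b e])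
      (auto simp flip: ab intro: less_imp_le)
  \<comment> \<open>The displacement \<open>a\<close> at time \<open>N\<close> comes from
    \<open>a / l ^ N\<close> at time 0.\<close>
  have "((*v) ?M ^^ N) (x + (a / l ^ N) *\<^sub>R v) = ((*v) ?M ^^ N) x + y N"
    using funpow_matrix_eigen_combination[OF v w, of N "a / l ^ N" 0] l(2)
    by (simp add: funpow_matrix_add ab \<open>b = 0\<close>)
  moreover have "torus_proj (((*v) ?M ^^ N) z) = torus_proj (((*v) ?M ^^ N) x + y N)"
    using y(1)[of N] by (simp add: torus_proj_eq_iff algebra_simps)
  ultimately have "(?T ^^ N) (torus_proj z) = (?T ^^ N) (torus_proj (x + (a / l ^ N) *\<^sub>R v))"
    by (simp add: torus_map_funpow_proj)
  then have "torus_proj z = torus_proj (x + (a / l ^ N) *\<^sub>R v)"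
    using inj_fn[OF inj, of N] by (simp add: inj_eq)
  then show "\<exists>s. torus_proj z = torus_proj (x + s *\<^sub>R v)" by blast
qed

section \<open>The groupoid in terms of the pair of eigenlines\<close>

text \<open>The parameters \<open>s\<close> and \<open>t\<close> are independent: the two translates
  of \<open>x\<close> agree only modulo the lattice.\<close>

definition line_pair_relation :: "real^2 \<Rightarrow> real^2 \<Rightarrow> (torus \<times> torus) set" where
  "line_pair_relation v w = {(torus_proj x, torus_proj z) | x z.
     (\<exists>s. torus_proj z = torus_proj (x + s *\<^sub>R v)) \<and> (\<exists>t. torus_proj z = torus_proj (x + t *\<^sub>R w))}"

text \<open>One radius serves both segments because the two eigenvalues have reciprocal
  moduli.\<close>

definition line_pair_piece :: "real^2 \<Rightarrow> real^2 \<Rightarrow> real \<Rightarrow> (torus \<times> torus) set" where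
  "line_pair_piece v w R = {(torus_proj x, torus_proj z) | x z.
     (\<exists>s. torus_proj z = torus_proj (x + s *\<^sub>R v) \<and> \<bar>s\<bar> < R) \<and>
     (\<exists>t. torus_proj z = torus_proj (x + t *\<^sub>R w) \<and> \<bar>t\<bar> < R)}"

text \<open>Substituting \<open>- s\<close> for \<open>s\<close> absorbs a reversed direction; the
  side condition must be even in \<open>s\<close>. This removes the sign ambiguity of unit
  eigenvectors.\<close>

lemma ex_multiple_minus:
  fixes v :: "'a::real_vector"
  assumes "\<And>s. Q (- s) = Q s"
  shows "(\<exists>s. P (s *\<^sub>R (- v)) \<and> Q s) \<longleftrightarrow> (\<exists>s. P (s *\<^sub>R v) \<and> Q s)"
  by (metis assms minus_minus scaleR_minus_left scaleR_minus_right)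

lemma torus_line_minus:
  "(\<exists>s. torus_proj z = torus_proj (x + s *\<^sub>R (- v))) \<longleftrightarrow>
    (\<exists>s. torus_proj z = torus_proj (x + s *\<^sub>R v))"
  using ex_multiple_minus[of "\<lambda>_. True" "\<lambda>u. torus_proj z = torus_proj (x + u)" v] by simp

lemma torus_segment_minus:
  "(\<exists>s. torus_proj z = torus_proj (x + s *\<^sub>R (- v)) \<and> \<bar>s\<bar> < R) \<longleftrightarrow>
    (\<exists>s. torus_proj z = torus_proj (x + s *\<^sub>R v) \<and> \<bar>s\<bar> < R)"
  using ex_multiple_minus[of "\<lambda>s. \<bar>s\<bar> < R" "\<lambda>u. torus_proj z = torus_proj (x + u)" v] by simp

lemma line_pair_relation_minus:
  "line_pair_relation (- v) w = line_pair_relation v w"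
  "line_pair_relation v (- w) = line_pair_relation v w"
  unfolding line_pair_relation_def torus_line_minus by (rule refl)+

lemma line_pair_piece_minus:
  "line_pair_piece (- v) w = line_pair_piece v w"
  "line_pair_piece v (- w) = line_pair_piece v w"
  unfolding line_pair_piece_def torus_segment_minus by (rule refl)+

lemma line_pair_relation_commute: "line_pair_relation v w = line_pair_relation w v"
  unfolding line_pair_relation_def by blast

lemma line_pair_piece_commute: "line_pair_piece v w = line_pair_piece w v"
  unfolding line_pair_piece_def by blast

lemma line_pair_piece_mono: "R \<le> S \<Longrightarrow> line_pair_piece v w R \<subseteq> line_pair_piece v w S"
  unfolding line_pair_piece_def by fastforce

section \<open>Comparison of inductive limit topologies\<close>

lemma openin_top_of_set_Int_mono:
  assumes "openin (top_of_set D) (U \<inter> D)" and "C \<subseteq> D"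
  shows "openin (top_of_set C) (U \<inter> C)"
proof -
  obtain T where "open T" "U \<inter> D = D \<inter> T" using assms(1) unfolding openin_open by blast
  moreover from this(2) have "U \<inter> C = C \<inter> T" using assms(2) by blast
  ultimately show ?thesis unfolding openin_open by blast
qed

text \<open>Relative openness passes from a piece to any smaller one, so testing on either
  filtration implies testing on the other.\<close>

lemma inductive_limit_topology_cofinal:
  assumes "\<And>n. \<exists>m. F n \<subseteq> F' m" and "\<And>m. \<exists>n. F' m \<subseteq> F n"
  shows "inductive_limit_topology G F = inductive_limit_topology G F'"
proof -
  have refine: "openin (top_of_set (H n)) (U \<inter> H n)"
    if "\<And>n. \<exists>m. H n \<subseteq> H' m" and "\<And>m. openin (top_of_set (H' m)) (U \<inter> H' m)"
    for H H' :: "nat \<Rightarrow> 'a set" and U n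
    using that(1)[of n] openin_top_of_set_Int_mono[OF that(2)] by blast
  have "(\<forall>n. openin (top_of_set (F n)) (U \<inter> F n)) \<longleftrightarrow>
      (\<forall>n. openin (top_of_set (F' n)) (U \<inter> F' n))" for U
  proof
    assume "\<forall>n. openin (top_of_set (F n)) (U \<inter> F n)"
    then show "\<forall>n. openin (top_of_set (F' n)) (U \<inter> F' n)"
      using refine[of F' F U, OF assms(2)] by simp
  next
    assume "\<forall>n. openin (top_of_set (F' n)) (U \<inter> F' n)"
    then show "\<forall>n. openin (top_of_set (F n)) (U \<inter> F n)"
      using refine[of F F' U, OF assms(1)] by simp
  qed
  then show ?thesis unfolding topology_eq openin_inductive_limit_topology by simp
qed

text \<open>Each radius of one sequence is exceeded by some radius of the other, so the filtrations
  are cofinal. This makes both the growth rate and the constant \<open>\<epsilon>\<close> disappear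
  from the topology.\<close>

lemma inductive_limit_topology_unbounded_radii:
  fixes P :: "real \<Rightarrow> 'a::topological_space set"
  assumes "mono P" and "filterlim r at_top sequentially" and "filterlim r' at_top sequentially"
  shows "inductive_limit_topology G (\<lambda>n. P (r n)) = inductive_limit_topology G (\<lambda>n. P (r' n))"
proof (rule inductive_limit_topology_cofinal)
  have larger: "\<exists>n. c \<le> f n" if "filterlim f at_top sequentially" for c :: real and f :: "nat \<Rightarrow> real"
  proof -
    have "eventually (\<lambda>n. c \<le> f n) sequentially" using that by (simp add: filterlim_at_top)
    then show ?thesis by (auto simp: eventually_sequentially)
  qed
  show "\<exists>m. P (r n) \<subseteq> P (r' m)" for n
    using larger[OF assms(3), of "r n"] monoD[OF assms(1)] by blast
  show "\<exists>m. P (r' n) \<subseteq> P (r m)" for n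
    using larger[OF assms(2), of "r' n"] monoD[OF assms(1)] by blast
qed

section \<open>Reduction of the groupoid to line data\<close>

lemma asymptotic_relation_eq_line_pair:
  assumes "invertible A" and "hyperbolic A"
  shows "asymptotic_relation A = line_pair_relation (stable_vector A) (unstable_vector A)"
proof -
  let ?ls = "stable_eigenvalue A" and ?lu = "unstable_eigenvalue A"
  note hA = hyperbolic_eigenpairs[OF assms]
  obtain A' where A': "A ** A' = mat 1" "A' ** A = mat 1" using assms by (auto simp: invertible_def)
  have TT': "torus_map A (torus_map A' x) = x" and T'T: "torus_map A' (torus_map A x) = x" for x
    by (simp_all add: A' torus_map_id flip: torus_map_mult)
  \<comment> \<open>Backward asymptotics under \<open>A\<close> become forward asymptotics under the
    inverse matrix \<open>A'\<close>.\<close>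
  have inv: "inv (torus_map A) = torus_map A'" by (rule inv_equality) (simp_all add: TT' T'T)
  have inj: "inj (torus_map A)" "inj (torus_map A')" by (metis injI TT' T'T)+
  have ne0: "?ls \<noteq> 0" "?lu \<noteq> 0" using hA(7) by auto
  have inverse_eigenpair: "eigenpair (real_matrix A') (inverse l) v"
    if v: "eigenpair (real_matrix A) l v" and "l \<noteq> 0" for l v
  proof -
    have "real_matrix A' *v (real_matrix A *v v) = v"
      by (simp add: matrix_vector_mul_assoc A' of_int_matrix_id flip: of_int_matrix_mult)
    then have "l *\<^sub>R (real_matrix A' *v v) = v"
      using v by (simp add: eigenpair_def scalar_mult_eq_scaleR matrix_vector_mult_scaleR)
    then have "real_matrix A' *v v = inverse l *\<^sub>R v" using \<open>l \<noteq> 0\<close> by (metis scaleR_scaleR left_inverse scaleR_one)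
    then show ?thesis using v by (simp add: eigenpair_def scalar_mult_eq_scaleR)
  qed
  have inverse_abs: "\<bar>inverse ?lu\<bar> < 1" "\<bar>inverse ?ls\<bar> > 1"
    using hA(5,6) ne0 by (auto simp: abs_inverse inverse_less_1_iff one_less_inverse_iff)
  have "(torus_proj x, torus_proj z) \<in> asymptotic_relation A \<longleftrightarrow>
      (\<exists>s. torus_proj z = torus_proj (x + s *\<^sub>R stable_vector A)) \<and>
      (\<exists>t. torus_proj z = torus_proj (x + t *\<^sub>R unstable_vector A))" for x z
    \<comment> \<open>For \<open>A'\<close> the roles are swapped: \<open>unstable_vector A\<close>
      is contracted, with eigenvalue \<open>inverse ?lu\<close>.\<close>
    using forward_asymptotic_iff[OF hA(1,2) hA(5) ne0(1) hA(6) inj(1), of x z]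
      forward_asymptotic_iff[OF inverse_eigenpair[OF hA(2) ne0(2)] inverse_eigenpair[OF hA(1) ne0(1)]
        inverse_abs(1) _ inverse_abs(2) inj(2), of x z] ne0
    by (simp add: asymptotic_relation_def inv)
  note iff = this
  show ?thesis
  proof (intro set_eqI iffI)
    fix p assume p: "p \<in> asymptotic_relation A"
    obtain x z where "p = (torus_proj x, torus_proj z)" by (metis surj_pair torus_proj_surj)
    then show "p \<in> line_pair_relation (stable_vector A) (unstable_vector A)"
      using p iff unfolding line_pair_relation_def by blast
  next
    fix p assume "p \<in> line_pair_relation (stable_vector A) (unstable_vector A)"
    then show "p \<in> asymptotic_relation A" using iff unfolding line_pair_relation_def by blast
  qed
qed

text \<open>Since the stable modulus is the inverse of the unstable one, both defining bounds
  rescale to the same radius.\<close>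

lemma asymptotic_piece_eq_line_pair:
  assumes "invertible A" and "hyperbolic A"
  shows "asymptotic_piece A \<epsilon> n =
    line_pair_piece (stable_vector A) (unstable_vector A) (\<epsilon> * \<bar>unstable_eigenvalue A\<bar> ^ n)"
proof -
  let ?u = "\<bar>unstable_eigenvalue A\<bar>"
  note hA = hyperbolic_eigenpairs[OF assms]
  have u: "?u ^ n > 0" using hA(6) by simp
  have s: "\<bar>stable_eigenvalue A\<bar> = inverse ?u"
    using hA(6,7) by (simp add: field_simps)
  have "inverse ?u ^ n * r < \<epsilon> \<longleftrightarrow> r < \<epsilon> * ?u ^ n" for r
    using u by (simp add: power_inverse field_simps)
  then show ?thesis unfolding asymptotic_piece_def line_pair_piece_def s by blast
qed

text \<open>A normal form free of eigenvalues and \<open>\<epsilon>\<close>; the radii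
  \<open>real n\<close> are just a reference sequence tending to infinity.\<close>

definition line_pair_topology :: "real^2 \<Rightarrow> real^2 \<Rightarrow> (torus \<times> torus) topology" where
  "line_pair_topology v w =
     inductive_limit_topology (line_pair_relation v w) (\<lambda>n. line_pair_piece v w (real n))"

lemma asymptotic_topology_eq_line_pair:
  assumes "invertible A" and "hyperbolic A" and "\<epsilon> > 0"
  shows "inductive_limit_topology (asymptotic_relation A) (asymptotic_piece A \<epsilon>) =
    line_pair_topology (stable_vector A) (unstable_vector A)"
proof -
  have "filterlim (\<lambda>n. \<epsilon> * \<bar>unstable_eigenvalue A\<bar> ^ n) at_top sequentially"
    using hyperbolic_eigenpairs(6)[OF assms(1,2)] \<open>\<epsilon> > 0\<close>
    by (intro filterlim_tendsto_pos_mult_at_top[OF tendsto_const]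
        filterlim_at_infinity_imp_filterlim_at_top filterlim_realpow_sequentially_gt1) auto
  then show ?thesis
    unfolding line_pair_topology_def asymptotic_relation_eq_line_pair[OF assms(1,2)]
      asymptotic_piece_eq_line_pair[OF assms(1,2), abs_def]
    by (intro inductive_limit_topology_unbounded_radii filterlim_real_sequentially)
      (auto intro!: monoI line_pair_piece_mono)
qed

text \<open>The operations are the same formulas for both matrices, so only arrows and topology must
  be compared, and both are line data.\<close>

lemma asymptotic_groupoid_eq_of_commute:
  assumes A: "invertible A" "hyperbolic A" and B: "invertible B" "hyperbolic B"
    and comm: "A ** B = B ** A" and "\<epsilon> > 0" and "\<delta> > 0"
  shows "asymptotic_groupoid A \<epsilon> = asymptotic_groupoid B \<delta>"
proof -
  let ?sA = "stable_vector A" and ?uA = "unstable_vector A"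
  let ?sB = "stable_vector B" and ?uB = "unstable_vector B"
  from commuting_hyperbolic_eigenvectors[OF A B comm]
  have "line_pair_relation ?sA ?uA = line_pair_relation ?sB ?uB \<and>
      line_pair_piece ?sA ?uA = line_pair_piece ?sB ?uB"
    \<comment> \<open>The line data differ by signs, and in the second case also by the order of the
      lines.\<close>
    by cases (auto simp only: line_pair_relation_minus line_pair_piece_minus
        line_pair_relation_commute[of ?uA ?sA] line_pair_piece_commute[of ?uA ?sA])
  then show ?thesis
    unfolding asymptotic_groupoid_def asymptotic_topology_eq_line_pair[OF A \<open>\<epsilon> > 0\<close>]
      asymptotic_topology_eq_line_pair[OF B \<open>\<delta> > 0\<close>]
    by (simp add: asymptotic_relation_eq_line_pair A B line_pair_topology_def)
qed

lemma star_isomorphic_refl: "star_isomorphic R R"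
  unfolding star_isomorphic_def star_isomorphism_def by (intro exI[of _ id]) simp

text \<open>Equal groupoids have equal C*-algebras, so the identity is the isomorphism. Taking
  \<open>B = A\<close> shows that the topology is independent of the choice of
  \<open>\<epsilon>\<close>.\<close>

theorem mainTheorem3:
  fixes A B :: "int^2^2" and \<epsilon> \<delta> :: real
  assumes "invertible A" and "invertible B"
    and "hyperbolic A" and "hyperbolic B"
    and "A ** B = B ** A"
    and "\<epsilon> > 0" and "\<delta> > 0"
  shows "asymptotic_groupoid A \<epsilon> = asymptotic_groupoid B \<delta> \<and>
         star_isomorphic (groupoid_cstar (asymptotic_groupoid A \<epsilon>))
                         (groupoid_cstar (asymptotic_groupoid B \<delta>))"
  using asymptotic_groupoid_eq_of_commute[of A B \<epsilon> \<delta>] assms star_isomorphic_refl by simp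

end
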